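(* Let $m$ be a positive integer and let $G$ be a simple graph on $n$ vertices with Seidel eigenvalues $\sigma_1,\sigma_2,\dots,\sigma_n$ satisfying $|\sigma_i|\geq \left(\frac{m-1}{m}\right)^2$ for all $1\le i\le n$. Then $D_m^*(D_m(G))$ and $D_m(D_m^*(G))$ are Seidel non-cospectral, Seidel equienergetic graphs if and only if $G$ has equal numbers of positive and negative Seidel eigenvalues.
   Context: For a simple graph $G$ with vertices $v_1,\dots,v_n$, $A(G)$ is its adjacency matrix. The Seidel matrix $S(G)=[s_{ij}]$ is the $n\times n$ matrix with $s_{ii}=0$, and for $i\neq j$, $s_{ij}=-1$ if $v_i$ is adjacent to $v_j$ and $s_{ij}=1$ otherwise; equivalently $S(G)=J-I-2A(G)$. The Seidel eigenvalues of $G$ are the eigenvalues of $S(G)$ (with multiplicity); the Seidel spectrum is their multiset. The Seidel energy is $SE(G)=\sum_{i=1}^n|\sigma_i|$. Two graphs are Seidel equienergetic if they have equal Seidel energy, and Seidel non-cospectral if their Seidel spectra differ. For a positive integer $m$ and a simple graph $H$ on $k$ vertices: $D_m(H)$ is the simple graph on $mk$ vertices with adjacency matrix $J_m\otimes A(H)$ (vertex set $\{1,\dots,m\}\times V(H)$, with $(a,u)\sim(b,v)$ iff $uv\in E(H)$), and $D_m^*(H)$ is the simple graph on $mk$ vertices with adjacency matrix $J_m\otimes(A(H)+I_k)-I_{mk}$ (vertex set $\{1,\dots,m\}\times V(H)$, with distinct $(a,u),(b,v)$ adjacent iff $u=v$ or $uv\in E(H)$). Here $J_m$ is the $m\times m$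 all-ones matrix and $\otimes$ is the Kronecker product. Thus $D_m^*(D_m(G))$ and $D_m(D_m^*(G))$ both have $m^2n$ vertices.
   Formalization: The formal statement requires m ≥ 2 and at least one vertex: for m = 1 both graphs are isomorphic to G, hence always cospectral, so the equivalence fails e.g. for G = K_2, and for n = 0 both spectra are empty. *)

theory Defs
  imports
    "Graph_Theory.Pair_Digraph"
    "Jordan_Normal_Form.Char_Poly"
    "HOL-Computational_Algebra.Polynomial"
begin

text \<open>
  A finite simple graph is a \<open>pair_graph\<close>: finite vertex set, irreflexive and symmetric arc set,
  so an edge \<open>uv\<close> is the pair of arcs \<open>(u,v)\<close> and \<open>(v,u)\<close>.

  The Seidel matrix depends on the enumeration \<open>v\<^sub>1, \<dots>, v\<^sub>n\<close> of the vertices (position \<open>i\<close> of the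
  list is \<open>v\<^sub>i\<^sub>+\<^sub>1\<close>). Another enumeration gives a permutation-similar matrix, so the spectrum below
  does not depend on the choice.
\<close>

definition vertex_list :: "'a pair_pre_digraph \<Rightarrow> 'a list" where
  "vertex_list G = (SOME vs. distinct vs \<and> set vs = pverts G)"

definition seidel_matrix :: "'a pair_pre_digraph \<Rightarrow> real mat" where
  "seidel_matrix G =
    (let vs = vertex_list G; n = length vs in
      mat n n (\<lambda>(i, j). if i = j then 0 else if (vs ! i, vs ! j) \<in> parcs G then - 1 else 1))"

text \<open>
  Eigenvalues with algebraic multiplicity. A Seidel matrix is real symmetric, so its characteristic
  polynomial splits over the reals and all \<open>n\<close> eigenvalues are real roots.
\<close>

definition seidel_spectrum :: "'a pair_pre_digraph \<Rightarrow> real multiset" where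
  "seidel_spectrum G = proots (char_poly (seidel_matrix G))"

definition seidel_energy :: "'a pair_pre_digraph \<Rightarrow> real" where
  "seidel_energy G = (\<Sum>\<sigma>\<in>#seidel_spectrum G. \<bar>\<sigma>\<bar>)"

definition seidel_equienergetic :: "'a pair_pre_digraph \<Rightarrow> 'b pair_pre_digraph \<Rightarrow> bool" where
  "seidel_equienergetic G H \<longleftrightarrow> seidel_energy G = seidel_energy H"

definition seidel_noncospectral :: "'a pair_pre_digraph \<Rightarrow> 'b pair_pre_digraph \<Rightarrow> bool" where
  "seidel_noncospectral G H \<longleftrightarrow> seidel_spectrum G \<noteq> seidel_spectrum H"

definition D :: "nat \<Rightarrow> 'a pair_pre_digraph \<Rightarrow> (nat \<times> 'a) pair_pre_digraph" where
  "D m H =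
    \<lparr> pverts = {1..m} \<times> pverts H,
      parcs = {((a, u), (b, v)) | a b u v. a \<in> {1..m} \<and> b \<in> {1..m} \<and> (u, v) \<in> parcs H} \<rparr>"

definition D_star :: "nat \<Rightarrow> 'a pair_pre_digraph \<Rightarrow> (nat \<times> 'a) pair_pre_digraph" where
  "D_star m H =
    \<lparr> pverts = {1..m} \<times> pverts H,
      parcs = {((a, u), (b, v)) | a b u v. a \<in> {1..m} \<and> b \<in> {1..m} \<and>
                 u \<in> pverts H \<and> v \<in> pverts H \<and>
                 (a, u) \<noteq> (b, v) \<and> (u = v \<or> (u, v) \<in> parcs H)} \<rparr>"

lemma pair_graph_D:
  assumes "pair_graph H"
  shows "pair_graph (D m H)"
proof -
  interpret pair_graph H by fact
  have sym: "(v, u) \<in> parcs H" if "(u, v) \<in> parcs H" for u v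
    using pair_sym_arcs that by (auto simp: symmetric_def elim: symE)
  have sub: "parcs (D m H) \<subseteq> pverts (D m H) \<times> pverts (D m H)"
    by (auto simp: D_def dest: in_arcsD1 in_arcsD2)
  have fin: "finite (pverts (D m H))"
    by (simp add: D_def)
  show ?thesis
    using sub fin finite_subset[OF sub]
    by unfold_locales
      (auto simp: D_def symmetric_def intro!: symI dest: in_arcsD1 in_arcsD2 sym pair_no_loops)
qed

lemma pair_graph_D_star:
  assumes "pair_graph H"
  shows "pair_graph (D_star m H)"
proof -
  interpret pair_graph H by fact
  have sym: "(v, u) \<in> parcs H" if "(u, v) \<in> parcs H" for u v
    using pair_sym_arcs that by (auto simp: symmetric_def elim: symE)
  have sub: "parcs (D_star m H) \<subseteq> pverts (D_star m H) \<times> pverts (D_star m H)"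
    by (auto simp: D_star_def)
  have fin: "finite (pverts (D_star m H))"
    by (simp add: D_star_def)
  show ?thesis
    using sub fin finite_subset[OF sub]
    by unfold_locales (auto simp: D_star_def symmetric_def intro!: symI dest: sym)
qed

end

theory Submission
  imports Defs
begin

text \<open>
  Up to a scalar multiple of the identity, the Seidel matrices of \<open>D m H\<close> and \<open>D_star m H\<close> are
  \<open>J\<^sub>m \<otimes> (S + I)\<close> and \<open>J\<^sub>m \<otimes> (S - I)\<close>, where \<open>S\<close> is the Seidel matrix of \<open>H\<close>. Writing \<open>J\<^sub>m \<otimes> B\<close> as
  \<open>P B P\<^sup>T\<close> with \<open>P\<^sup>T P = m I\<close>, the identity \<open>x\<^sup>k det (x I - A C) = x\<^sup>N det (x I - C A)\<close> yields their
  spectra. For the two iterated graphs, with \<open>c = (m - 1)\<^sup>2\<close>, one spectrum consists of the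
  \<open>m\<^sup>2 \<sigma> + c\<close>, of \<open>1 - 2 m\<close> and of \<open>1\<close>, the other of the \<open>m\<^sup>2 \<sigma> - c\<close>, of \<open>2 m - 1\<close> and of \<open>- 1\<close>,
  with the same multiplicities. The multiplicity of \<open>1\<close> always separates them. The hypothesis
  \<open>\<bar>\<sigma>\<bar> \<ge> c / m\<^sup>2\<close> gives \<open>\<bar>m\<^sup>2 \<sigma> + c\<bar> - \<bar>m\<^sup>2 \<sigma> - c\<bar> = 2 c sgn \<sigma>\<close>, so the energies differ by \<open>2 c\<close> times
  the difference between the numbers of positive and negative eigenvalues.
\<close>

section \<open>Determinants and roots of polynomials\<close>

text \<open>Sylvester's determinant identity. Right multiplication of \<open>?M\<close> by
  \<open>?L\<close> clears its lower left block, by \<open>?U\<close> its upper right one; comparing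
  the two expressions for \<open>det ?M\<close> avoids dividing by \<open>x\<close>.\<close>

lemma det_smult_one_minus_mult_commute:
  fixes A C :: "'a :: idom mat"
  assumes A: "A \<in> carrier_mat N k" and C: "C \<in> carrier_mat k N"
  shows "x ^ k * det (x \<cdot>\<^sub>m 1\<^sub>m N - A * C) = x ^ N * det (x \<cdot>\<^sub>m 1\<^sub>m k - C * A)"
proof -
  let ?M = "four_block_mat (x \<cdot>\<^sub>m 1\<^sub>m N) A C (1\<^sub>m k)"
  let ?L = "four_block_mat (1\<^sub>m N) (0\<^sub>m N k) (- C) (1\<^sub>m k)"
  let ?U = "four_block_mat (1\<^sub>m N) (- A) (0\<^sub>m k N) (x \<cdot>\<^sub>m 1\<^sub>m k)"
  have M: "?M \<in> carrier_mat (N + k) (N + k)"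
    using A C by auto
  have L: "?L \<in> carrier_mat (N + k) (N + k)"
    using A C by auto
  have U: "?U \<in> carrier_mat (N + k) (N + k)"
    using A C by auto
  have "?M * ?L = four_block_mat (x \<cdot>\<^sub>m 1\<^sub>m N - A * C) A (0\<^sub>m k N) (1\<^sub>m k)"
    using A C
    by (subst mult_four_block_mat[where ?nr1.0 = N and ?n1.0 = N and ?n2.0 = k and ?nr2.0 = k
          and ?nc1.0 = N and ?nc2.0 = k])
      (auto intro!: cong_four_block_mat minus_add_uminus_mat[symmetric] eq_matI)
  then have "det ?M * det ?L = det (x \<cdot>\<^sub>m 1\<^sub>m N - A * C)"
    using A C det_mult[OF M L]
      det_four_block_mat_lower_left_zero[of "x \<cdot>\<^sub>m 1\<^sub>m N - A * C" N A k "0\<^sub>m k N" "1\<^sub>m k"]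
    by (simp add: minus_carrier_mat)
  moreover have "det ?L = 1"
    using C by (subst det_four_block_mat_upper_right_zero[where n = N and m = k]) auto
  ultimately have 1: "det ?M = det (x \<cdot>\<^sub>m 1\<^sub>m N - A * C)"
    by simp
  have col: "col A j \<in> carrier_vec N" for j
    using A by auto
  have "?M * ?U = four_block_mat (x \<cdot>\<^sub>m 1\<^sub>m N) (0\<^sub>m N k) C (x \<cdot>\<^sub>m 1\<^sub>m k - C * A)"
    using A C
    by (subst mult_four_block_mat[where ?nr1.0 = N and ?n1.0 = N and ?n2.0 = k and ?nr2.0 = k
          and ?nc1.0 = N and ?nc2.0 = k])
      (auto intro!: cong_four_block_mat eq_matI simp: scalar_prod_left_unit[OF col])
  then have "det ?M * det ?U = x ^ N * det (x \<cdot>\<^sub>m 1\<^sub>m k - C * A)"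
    using A C det_mult[OF M U]
      det_four_block_mat_upper_right_zero[of "x \<cdot>\<^sub>m 1\<^sub>m N" N "0\<^sub>m N k" k C "x \<cdot>\<^sub>m 1\<^sub>m k - C * A"]
    by (simp add: minus_carrier_mat)
  moreover have "det ?U = x ^ k"
    using A by (subst det_four_block_mat_lower_left_zero[where n = N and m = k]) auto
  ultimately show ?thesis
    using 1 by (simp add: mult.commute)
qed

lemma poly_char_poly:
  fixes A :: "'a :: field mat"
  assumes "A \<in> carrier_mat n n"
  shows "poly (char_poly A) x = det (x \<cdot>\<^sub>m 1\<^sub>m n - A)"
proof -
  have "- char_matrix A x = x \<cdot>\<^sub>m 1\<^sub>m n - A"
    using assms by (intro eq_matI) (auto simp: char_matrix_def)
  then show ?thesis
    using char_poly_matrix[OF assms] by simp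
qed

text \<open>A nonzero difference would have finitely many roots. This recovers the one point lost
  when a power of a linear factor is cancelled.\<close>

lemma poly_eqI_almost_all:
  fixes p q :: "'a :: {comm_ring_1, ring_no_zero_divisors, ring_char_0} poly"
  assumes "\<And>x. x \<noteq> a \<Longrightarrow> poly p x = poly q x"
  shows "p = q"
proof (rule ccontr)
  assume "p \<noteq> q"
  then have "finite {x. poly (p - q) x = 0}"
    by (intro poly_roots_finite) simp
  moreover have "- {a} \<subseteq> {x. poly (p - q) x = 0}"
    using assms by auto
  ultimately have "finite (- {a})"
    by (rule rev_finite_subset)
  then show False
    using infinite_UNIV_char_0[where 'a = 'a] by (simp add: finite_compl)
qed

text \<open>The factor \<open>[:- ?r, 1:]\<close> pulls back to \<open>c\<close> times
  \<open>[:- a, 1:]\<close>, and the pulled-back cofactor stays nonzero at \<open>a\<close>.\<close>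

lemma order_pcompose_linear:
  fixes p :: "'a :: field poly"
  assumes "p \<noteq> 0" "c \<noteq> 0"
  shows "Polynomial.order a (pcompose p [:b, c:]) = Polynomial.order (b + c * a) p"
proof -
  let ?r = "b + c * a"
  obtain q where q: "p = [:- ?r, 1:] ^ Polynomial.order ?r p * q" "\<not> [:- ?r, 1:] dvd q"
    using order_decomp[OF assms(1)] by blast
  have lin: "pcompose [:- ?r, 1:] [:b, c:] = Polynomial.smult c [:- a, 1:]"
    by (simp add: pcompose_pCons algebra_simps)
  have q0: "poly (pcompose q [:b, c:]) a \<noteq> 0"
    using q(2) by (simp add: poly_pcompose poly_eq_0_iff_dvd mult.commute)
  then have qn0: "pcompose q [:b, c:] \<noteq> 0"
    by auto
  have "pcompose p [:b, c:] =
      Polynomial.smult (c ^ Polynomial.order ?r p) ([:- a, 1:] ^ Polynomial.order ?r p * pcompose q [:b, c:])"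
    by (subst q(1)) (simp only: pcompose_mult pcompose_hom.hom_power lin smult_power mult_smult_left)
  moreover have "Polynomial.order a ([:- a, 1:] ^ Polynomial.order ?r p * pcompose q [:b, c:]) = Polynomial.order ?r p"
    using qn0 q0 by (subst order_mult) (auto simp: order_power_n_n order_0I)
  ultimately show ?thesis
    using assms(2) by (simp add: order_smult)
qed

lemma proots_pcompose_linear:
  fixes p :: "'a :: field poly"
  assumes "p \<noteq> 0" "c \<noteq> 0"
  shows "proots (pcompose p [:b, c:]) = image_mset (\<lambda>x. (x - b) / c) (proots p)"
proof (rule multiset_eqI)
  fix a
  \<comment> \<open>The map is injective, so its fibre over \<open>a\<close> has at most one
    point.\<close>
  have "{x. x \<in># proots p \<and> a = (x - b) / c} =
      (if b + c * a \<in># proots p then {b + c * a} else {})"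
    using assms(2) by (auto simp: field_simps simp del: set_count_proots)
  then have "count (image_mset (\<lambda>x. (x - b) / c) (proots p)) a = count (proots p) (b + c * a)"
    unfolding count_image_mset' by (auto simp: count_eq_zero_iff simp del: count_proots set_count_proots)
  moreover have "pcompose p [:b, c:] \<noteq> 0"
    using assms by (simp add: pcompose_eq_0_iff)
  then have "count (proots (pcompose p [:b, c:])) a = count (proots p) (b + c * a)"
    using assms by (simp add: order_pcompose_linear)
  ultimately show "count (proots (pcompose p [:b, c:])) a =
      count (image_mset (\<lambda>x. (x - b) / c) (proots p)) a"
    by simp
qed

section \<open>Spectrum of a blown-up matrix\<close>

text \<open>With \<open>f\<close> the projection of \<open>{1..m} \<times> V\<close> onto \<open>V\<close>, the matrix below is
  \<open>J\<^sub>m \<otimes> (S + s I) - s I\<close> for an arbitrary enumeration of the product.\<close>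

lemma proots_char_poly_blow_up:
  fixes S :: "'a :: field_char_0 mat"
  assumes S: "S \<in> carrier_mat k k"
    and f: "\<And>i. i < N \<Longrightarrow> f i < k"
    and fibre: "\<And>j. j < k \<Longrightarrow> card {i \<in> {..<N}. f i = j} = m"
    and N: "N = m * k" and m: "m > 0"
    and T: "T = mat N N (\<lambda>(i, j).
      S $$ (f i, f j) + (if f i = f j then s else 0) - (if i = j then s else 0))"
  shows "proots (char_poly T) =
    image_mset (\<lambda>\<sigma>. of_nat m * (\<sigma> + s) - s) (proots (char_poly S)) +
      replicate_mset ((m - 1) * k) (- s)"
proof -
  \<comment> \<open>\<open>P\<close> is the incidence matrix of the fibres of \<open>f\<close>, so
    \<open>P B P^T\<close> repeats the entries of \<open>B\<close> along fibres and equals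
    \<open>T + s I\<close>.\<close>
  define P :: "'a mat" where "P = mat N k (\<lambda>(i, j). if f i = j then 1 else 0)"
  define B where "B = S + s \<cdot>\<^sub>m 1\<^sub>m k"
  let ?m = "of_nat m :: 'a"
  have m0: "?m \<noteq> 0"
    using m by simp
  have P: "P \<in> carrier_mat N k"
    by (simp add: P_def)
  have PT: "transpose_mat P \<in> carrier_mat k N"
    using P by simp
  have B: "B \<in> carrier_mat k k"
    using S by (simp add: B_def)
  have Tc: "T \<in> carrier_mat N N"
    by (simp add: T)
  have C: "B * transpose_mat P \<in> carrier_mat k N"
    using B PT by simp
  have Ce: "(B * transpose_mat P) $$ (i, j) = B $$ (i, f j)" if "i < k" "j < N" for i j
  proof -
    have "(B * transpose_mat P) $$ (i, j) = (\<Sum>l<k. B $$ (i, l) * P $$ (j, l))"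
      using that B P by (simp add: scalar_prod_def atLeast0LessThan)
    also have "\<dots> = (\<Sum>l<k. if l = f j then B $$ (i, l) else 0)"
      using that by (intro sum.cong) (auto simp: P_def)
    also have "\<dots> = B $$ (i, f j)"
      using that f by simp
    finally show ?thesis .
  qed
  have PBe: "(P * (B * transpose_mat P)) $$ (i, j) = B $$ (f i, f j)" if "i < N" "j < N" for i j
  proof -
    have "(P * (B * transpose_mat P)) $$ (i, j) =
        (\<Sum>l<k. P $$ (i, l) * (B * transpose_mat P) $$ (l, j))"
      using that P carrier_matD[OF C]
      by (subst index_mult_mat(1)) (simp_all add: scalar_prod_def[of "row P i"] atLeast0LessThan
          del: index_mult_mat)
    also have "\<dots> = (\<Sum>l<k. if l = f i then B $$ (l, f j) else 0)"
      using that by (intro sum.cong) (auto simp: P_def Ce[unfolded P_def])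
    also have "\<dots> = B $$ (f i, f j)"
      using that f by simp
    finally show ?thesis .
  qed
  \<comment> \<open>Columns of \<open>P\<close> have disjoint supports, each a fibre of size
    \<open>m\<close>.\<close>
  have PP: "transpose_mat P * P = ?m \<cdot>\<^sub>m 1\<^sub>m k"
  proof (rule eq_matI)
    fix i j assume "i < dim_row (?m \<cdot>\<^sub>m 1\<^sub>m k)" "j < dim_col (?m \<cdot>\<^sub>m 1\<^sub>m k)"
    then have ij: "i < k" "j < k"
      by auto
    have "(transpose_mat P * P) $$ (i, j) = (\<Sum>l<N. P $$ (l, i) * P $$ (l, j))"
      using ij P by (simp add: scalar_prod_def atLeast0LessThan)
    also have "\<dots> = (\<Sum>l<N. if f l = i then (if i = j then 1 else 0) else 0)"
      using ij by (intro sum.cong) (auto simp: P_def)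
    also have "\<dots> = (\<Sum>l\<in>{l \<in> {..<N}. f l = i}. if i = j then 1 else 0)"
      by (rule sum.inter_filter[symmetric]) simp
    also have "\<dots> = (?m \<cdot>\<^sub>m 1\<^sub>m k) $$ (i, j)"
      using ij fibre by simp
    finally show "(transpose_mat P * P) $$ (i, j) = (?m \<cdot>\<^sub>m 1\<^sub>m k) $$ (i, j)" .
  qed (use P in auto)
  have CP: "(B * transpose_mat P) * P = ?m \<cdot>\<^sub>m B"
    using B P PT by (simp add: assoc_mult_mat[OF B PT P] PP mult_smult_distrib[OF B one_carrier_mat])
  \<comment> \<open>Away from \<open>y = - s\<close> the factor \<open>(y + s) ^ k\<close> of the
    determinant identity can be cancelled.\<close>
  have eq: "poly (char_poly T) y =
      (y + s) ^ ((m - 1) * k) * (?m ^ k * poly (char_poly S) ((y + s) / ?m - s))"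
    if y: "y \<noteq> - s" for y
  proof -
    let ?x = "y + s"
    have x: "?x \<noteq> 0"
      using y by (simp add: add_eq_0_iff2)
    have "y \<cdot>\<^sub>m 1\<^sub>m N - T = ?x \<cdot>\<^sub>m 1\<^sub>m N - P * (B * transpose_mat P)"
    proof (rule eq_matI)
      fix i j assume "i < dim_row (?x \<cdot>\<^sub>m 1\<^sub>m N - P * (B * transpose_mat P))"
        "j < dim_col (?x \<cdot>\<^sub>m 1\<^sub>m N - P * (B * transpose_mat P))"
      then have ij: "i < N" "j < N"
        using P B by auto
      have PBd: "dim_row (P * (B * transpose_mat P)) = N" "dim_col (P * (B * transpose_mat P)) = N"
        using P by auto
      have "(?x \<cdot>\<^sub>m 1\<^sub>m N - P * (B * transpose_mat P)) $$ (i, j) =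
          (if i = j then ?x else 0) - B $$ (f i, f j)"
        using ij PBd by (subst index_minus_mat) (auto simp: PBe simp del: index_mult_mat)
      then show "(y \<cdot>\<^sub>m 1\<^sub>m N - T) $$ (i, j) = (?x \<cdot>\<^sub>m 1\<^sub>m N - P * (B * transpose_mat P)) $$ (i, j)"
        using ij S f by (simp add: T B_def)
    qed (use P B T in auto)
    then have "?x ^ k * poly (char_poly T) y = ?x ^ N * det (?x \<cdot>\<^sub>m 1\<^sub>m k - ?m \<cdot>\<^sub>m B)"
      using det_smult_one_minus_mult_commute[OF P C, of ?x] Tc by (simp add: poly_char_poly CP)
    also have "?x \<cdot>\<^sub>m 1\<^sub>m k - ?m \<cdot>\<^sub>m B = ?m \<cdot>\<^sub>m ((?x / ?m - s) \<cdot>\<^sub>m 1\<^sub>m k - S)"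
      using S m0 by (intro eq_matI) (auto simp: B_def field_simps)
    also have "det \<dots> = ?m ^ k * poly (char_poly S) (?x / ?m - s)"
      using S by (simp add: poly_char_poly)
    \<comment> \<open>The excess exponent \<open>(m - 1) * k\<close> left after cancelling becomes
      the multiplicity of the eigenvalue \<open>- s\<close>.\<close>
    also have "N = k + (m - 1) * k"
      using m N by (cases m) auto
    finally show ?thesis
      using x by (simp add: power_add mult.assoc)
  qed
  have "char_poly T = [:s, 1:] ^ ((m - 1) * k) *
      Polynomial.smult (?m ^ k) (pcompose (char_poly S) [:s / ?m - s, 1 / ?m:])"
    by (rule poly_eqI_almost_all[of "- s"])
      (simp add: eq poly_pcompose add_divide_distrib algebra_simps)
  moreover have S0: "char_poly S \<noteq> 0"
    using degree_monic_char_poly[OF S] by auto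
  then have "pcompose (char_poly S) [:s / ?m - s, 1 / ?m:] \<noteq> 0"
    using m0 by (simp add: pcompose_eq_0_iff)
  ultimately have "proots (char_poly T) = replicate_mset ((m - 1) * k) (- s) +
      image_mset (\<lambda>\<sigma>. (\<sigma> - (s / ?m - s)) / (1 / ?m)) (proots (char_poly S))"
    using m0 S0
    by (simp add: proots_mult proots_power proots_pcompose_linear repeat_mset_replicate_mset
        flip: replicate_mset_Suc)
  also have "(\<lambda>\<sigma>. (\<sigma> - (s / ?m - s)) / (1 / ?m)) = (\<lambda>\<sigma>. ?m * (\<sigma> + s) - s)"
    using m0 by (auto simp: field_simps)
  finally show ?thesis
    by (simp add: add.commute)
qed

section \<open>Seidel spectra of the two constructions\<close>

lemma vertex_list:
  assumes "pair_graph G"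
  shows "distinct (vertex_list G)" "set (vertex_list G) = pverts G"
    "length (vertex_list G) = card (pverts G)"
proof -
  interpret pair_graph G by fact
  have "\<exists>vs. distinct vs \<and> set vs = pverts G"
    using finite_distinct_list[OF pair_finite_verts] by blast
  then have *: "distinct (vertex_list G) \<and> set (vertex_list G) = pverts G"
    unfolding vertex_list_def by (rule someI_ex)
  then show "distinct (vertex_list G)" "set (vertex_list G) = pverts G"
    by auto
  show "length (vertex_list G) = card (pverts G)"
    using * distinct_card by fastforce
qed

lemma seidel_matrix_carrier:
  assumes "pair_graph G"
  shows "seidel_matrix G \<in> carrier_mat (card (pverts G)) (card (pverts G))"
  using vertex_list(3)[OF assms] by (simp add: seidel_matrix_def Let_def)

lemma size_seidel_spectrum_le:
  assumes "pair_graph G"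
  shows "size (seidel_spectrum G) \<le> card (pverts G)"
  using size_proots_le[of "char_poly (seidel_matrix G)"]
    degree_monic_char_poly[OF seidel_matrix_carrier[OF assms]]
  by (simp add: seidel_spectrum_def)

text \<open>Treats both constructions at once: \<open>s\<close> is the Seidel entry between distinct
  copies of one vertex. The work lies in relating the two unrelated enumerations of \<open>G\<close>
  and \<open>K\<close>.\<close>

lemma seidel_spectrum_blow_up:
  fixes G :: "'a pair_pre_digraph" and K :: "(nat \<times> 'a) pair_pre_digraph"
  assumes G: "pair_graph G" and K: "pair_graph K" and m: "m > 0"
    and verts: "pverts K = {1..m} \<times> pverts G"
    and arcs: "\<And>p q. p \<in> pverts K \<Longrightarrow> q \<in> pverts K \<Longrightarrow> p \<noteq> q \<Longrightarrow>
      (if (p, q) \<in> parcs K then - 1 else 1) =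
      (if snd p = snd q then s else if (snd p, snd q) \<in> parcs G then - 1 else 1)"
  shows "seidel_spectrum K = image_mset (\<lambda>\<sigma>. real m * (\<sigma> + s) - s) (seidel_spectrum G) +
    replicate_mset ((m - 1) * card (pverts G)) (- s)"
proof -
  define vs where "vs = vertex_list G"
  define ws where "ws = vertex_list K"
  let ?k = "card (pverts G)" and ?N = "card (pverts K)"
  note vs = vertex_list[OF G, folded vs_def] and ws = vertex_list[OF K, folded ws_def]
  have "\<exists>l<?k. vs ! l = snd (ws ! i)" if "i < ?N" for i
  proof -
    have "ws ! i \<in> pverts K"
      using that ws by (metis nth_mem)
    then have "snd (ws ! i) \<in> set vs"
      using verts vs by auto
    then show ?thesis
      using vs by (metis in_set_conv_nth)
  qed
  \<comment> \<open>\<open>f\<close> is the projection to the second component, read on list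
    positions.\<close>
  then obtain f where f: "\<And>i. i < ?N \<Longrightarrow> f i < ?k" "\<And>i. i < ?N \<Longrightarrow> vs ! f i = snd (ws ! i)"
    by metis
  have fibre: "card {i \<in> {..<?N}. f i = j} = m" if j: "j < ?k" for j
  proof -
    have "bij_betw ((!) ws) {i \<in> {..<?N}. f i = j} ({1..m} \<times> {vs ! j})"
    proof (rule bij_betw_imageI)
      show "inj_on ((!) ws) {i \<in> {..<?N}. f i = j}"
        using ws by (auto simp: inj_on_def nth_eq_iff_index_eq)
      show "(!) ws ` {i \<in> {..<?N}. f i = j} = {1..m} \<times> {vs ! j}"
      proof (intro equalityI subsetI)
        fix p assume "p \<in> (!) ws ` {i \<in> {..<?N}. f i = j}"
        then obtain i where i: "i < ?N" "f i = j" "p = ws ! i"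
          by auto
        then have "p \<in> pverts K"
          using ws by (metis nth_mem)
        then show "p \<in> {1..m} \<times> {vs ! j}"
          using i f(2)[of i] verts by (auto simp: mem_Times_iff)
      next
        fix p assume p: "p \<in> {1..m} \<times> {vs ! j}"
        have "vs ! j \<in> pverts G"
          using vs j by (metis nth_mem)
        then have "p \<in> set ws"
          using p verts ws by auto
        then obtain i where i: "i < ?N" "ws ! i = p"
          using ws by (metis in_set_conv_nth)
        then have "vs ! f i = vs ! j"
          using f(2)[of i] p by (auto simp: mem_Times_iff)
        then have "f i = j"
          using vs f(1)[of i] i j by (simp add: nth_eq_iff_index_eq)
        then show "p \<in> (!) ws ` {i \<in> {..<?N}. f i = j}"
          using i by auto
      qed
    qed
    then show ?thesis
      by (simp add: bij_betw_same_card)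
  qed
  have N: "?N = m * ?k"
    by (simp add: verts card_cartesian_product)
  have T: "seidel_matrix K = mat ?N ?N (\<lambda>(i, j). seidel_matrix G $$ (f i, f j) +
      (if f i = f j then s else 0) - (if i = j then s else 0))"
  proof (rule eq_matI)
    fix i j assume "i < dim_row (mat ?N ?N (\<lambda>(i, j). seidel_matrix G $$ (f i, f j) +
        (if f i = f j then s else 0) - (if i = j then s else 0)))"
      "j < dim_col (mat ?N ?N (\<lambda>(i, j). seidel_matrix G $$ (f i, f j) +
        (if f i = f j then s else 0) - (if i = j then s else 0)))"
    then have ij: "i < ?N" "j < ?N"
      by auto
    have eqK: "seidel_matrix K $$ (i, j) =
        (if i = j then 0 else if (ws ! i, ws ! j) \<in> parcs K then - 1 else 1)"
      using ij ws by (simp add: seidel_matrix_def Let_def flip: ws_def)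
    have eqG: "seidel_matrix G $$ (f i, f j) =
        (if f i = f j then 0 else if (vs ! f i, vs ! f j) \<in> parcs G then - 1 else 1)"
      using ij f vs by (simp add: seidel_matrix_def Let_def flip: vs_def)
    have ff: "f i = f j \<longleftrightarrow> snd (ws ! i) = snd (ws ! j)"
      using ij f vs by (metis nth_eq_iff_index_eq)
    have w: "ws ! i \<in> pverts K" "ws ! j \<in> pverts K"
      using ij ws by (metis nth_mem)+
    have "i \<noteq> j \<Longrightarrow> ws ! i \<noteq> ws ! j"
      using ij ws by (simp add: nth_eq_iff_index_eq)
    then have "i \<noteq> j \<Longrightarrow> seidel_matrix K $$ (i, j) = seidel_matrix G $$ (f i, f j) +
        (if f i = f j then s else 0)"
      using arcs[OF w] ij by (simp add: eqK eqG ff f)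
    \<comment> \<open>On the diagonal the two occurrences of \<open>s\<close> cancel.\<close>
    then show "seidel_matrix K $$ (i, j) = mat ?N ?N (\<lambda>(i, j). seidel_matrix G $$ (f i, f j) +
        (if f i = f j then s else 0) - (if i = j then s else 0)) $$ (i, j)"
      using ij eqK eqG by auto
  qed (use seidel_matrix_carrier[OF K] in auto)
  show ?thesis
    unfolding seidel_spectrum_def
    by (rule proots_char_poly_blow_up[OF seidel_matrix_carrier[OF G] f(1) fibre N m T])
qed

text \<open>Since \<open>G\<close> has no loops, copies of a vertex are non-adjacent, which gives
  \<open>s = 1\<close>.\<close>

lemma seidel_spectrum_D:
  assumes G: "pair_graph G" and m: "m > 0"
  shows "seidel_spectrum (D m G) = image_mset (\<lambda>\<sigma>. real m * (\<sigma> + 1) - 1) (seidel_spectrum G) +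
    replicate_mset ((m - 1) * card (pverts G)) (- 1)"
proof (rule seidel_spectrum_blow_up[OF G pair_graph_D[OF G] m])
  interpret pair_graph G by fact
  show "(if (p, q) \<in> parcs (D m G) then - 1 else 1) =
      (if snd p = snd q then 1 else if (snd p, snd q) \<in> parcs G then - 1 else (1 :: real))"
    if "p \<in> pverts (D m G)" "q \<in> pverts (D m G)" for p q
    using that by (cases p; cases q) (auto simp: D_def dest: pair_no_loops)
qed (simp add: D_def)

text \<open>Distinct copies of a vertex are adjacent, which gives \<open>s = - 1\<close>.\<close>

lemma seidel_spectrum_D_star:
  assumes G: "pair_graph G" and m: "m > 0"
  shows "seidel_spectrum (D_star m G) =
    image_mset (\<lambda>\<sigma>. real m * (\<sigma> - 1) + 1) (seidel_spectrum G) +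
    replicate_mset ((m - 1) * card (pverts G)) 1"
proof -
  have "seidel_spectrum (D_star m G) =
    image_mset (\<lambda>\<sigma>. real m * (\<sigma> + (- 1)) - (- 1)) (seidel_spectrum G) +
    replicate_mset ((m - 1) * card (pverts G)) (- (- 1))"
  proof (rule seidel_spectrum_blow_up[OF G pair_graph_D_star[OF G] m])
    show "(if (p, q) \<in> parcs (D_star m G) then - 1 else 1) =
        (if snd p = snd q then - 1 else if (snd p, snd q) \<in> parcs G then - 1 else (1 :: real))"
      if "p \<in> pverts (D_star m G)" "q \<in> pverts (D_star m G)" "p \<noteq> q" for p q
      using that by (cases p; cases q) (auto simp: D_star_def)
  qed (simp add: D_star_def)
  then show ?thesis
    by simp
qed

section \<open>The iterated graphs\<close>

text \<open>The outer step sends the eigenvalue \<open>- 1\<close> created by \<open>D\<close> to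
  \<open>1 - 2 * m\<close> and adds new eigenvalues \<open>1\<close>, with a multiplicity taken from
  the \<open>m * n\<close> vertices of \<open>D m G\<close>.\<close>

lemma seidel_spectrum_D_star_D:
  assumes G: "pair_graph G" and m: "m > 0"
  shows "seidel_spectrum (D_star m (D m G)) =
    image_mset (\<lambda>\<sigma>. (real m)\<^sup>2 * \<sigma> + (real m - 1)\<^sup>2) (seidel_spectrum G) +
    replicate_mset ((m - 1) * card (pverts G)) (1 - 2 * real m) +
    replicate_mset ((m - 1) * (m * card (pverts G))) 1"
proof -
  have "card (pverts (D m G)) = m * card (pverts G)"
    by (simp add: D_def card_cartesian_product)
  moreover have "(\<lambda>\<sigma>. real m * (real m * (\<sigma> + 1) - 1 - 1) + 1) =
      (\<lambda>\<sigma>. (real m)\<^sup>2 * \<sigma> + (real m - 1)\<^sup>2)"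
    by (auto simp: power2_eq_square algebra_simps)
  ultimately show ?thesis
    using m
    by (simp add: seidel_spectrum_D_star[OF pair_graph_D[OF G] m] seidel_spectrum_D[OF G m]
        multiset.map_comp comp_def image_replicate_mset mult.commute)
qed

text \<open>In this order the inner eigenvalue \<open>1\<close> goes to \<open>2 * m - 1\<close>,
  and the affine shift changes sign.\<close>

lemma seidel_spectrum_D_D_star:
  assumes G: "pair_graph G" and m: "m > 0"
  shows "seidel_spectrum (D m (D_star m G)) =
    image_mset (\<lambda>\<sigma>. (real m)\<^sup>2 * \<sigma> - (real m - 1)\<^sup>2) (seidel_spectrum G) +
    replicate_mset ((m - 1) * card (pverts G)) (2 * real m - 1) +
    replicate_mset ((m - 1) * (m * card (pverts G))) (- 1)"
proof -
  have "card (pverts (D_star m G)) = m * card (pverts G)"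
    by (simp add: D_star_def card_cartesian_product)
  moreover have "(\<lambda>\<sigma>. real m * (real m * (\<sigma> - 1) + 1 + 1) - 1) =
      (\<lambda>\<sigma>. (real m)\<^sup>2 * \<sigma> - (real m - 1)\<^sup>2)"
    by (auto simp: power2_eq_square algebra_simps)
  ultimately show ?thesis
    using m
    by (simp add: seidel_spectrum_D[OF pair_graph_D_star[OF G] m] seidel_spectrum_D_star[OF G m]
        multiset.map_comp comp_def image_replicate_mset mult.commute)
qed

section \<open>Comparison of spectra and energies\<close>

text \<open>As \<open>a * \<bar>\<sigma>\<bar>\<close> is at least \<open>c\<close>, a shift by
  \<open>c\<close> never carries \<open>a * \<sigma>\<close> across zero, so both absolute values
  open with the sign of \<open>\<sigma>\<close>.\<close>

lemma sum_abs_shift_diff: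
  fixes A :: "real multiset"
  assumes "a > 0" "c > 0" "\<forall>\<sigma> \<in># A. \<bar>\<sigma>\<bar> \<ge> c / a"
  shows "(\<Sum>\<sigma>\<in>#A. \<bar>a * \<sigma> + c\<bar>) - (\<Sum>\<sigma>\<in>#A. \<bar>a * \<sigma> - c\<bar>) =
    2 * c * (real (size {#\<sigma> \<in># A. \<sigma> > 0#}) - real (size {#\<sigma> \<in># A. \<sigma> < 0#}))"
  using assms(3)
proof (induction A)
  case empty
  then show ?case by simp
next
  case (add \<sigma> A)
  have "c \<le> a * \<bar>\<sigma>\<bar>"
    using add.prems assms by (simp add: field_simps)
  moreover have "a * \<sigma> < 0" if "\<sigma> < 0"
    using that assms(1) by (simp add: mult_pos_neg)
  \<comment> \<open>Positivity of \<open>c\<close> excludes \<open>\<sigma> = 0\<close>, so each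
    element enters exactly one of the two sizes.\<close>
  ultimately have "\<sigma> \<noteq> 0" "\<bar>a * \<sigma> + c\<bar> - \<bar>a * \<sigma> - c\<bar> = 2 * c * sgn \<sigma>"
    using assms(2) by (cases \<sigma> "0 :: real" rule: linorder_cases; simp)+
  then show ?case
    using add by (cases \<sigma> "0 :: real" rule: linorder_cases) (auto simp: algebra_simps)
qed

text \<open>For \<open>m = 1\<close> both spectra reduce to that of \<open>G\<close>, and for an
  empty \<open>G\<close> both are empty; non-cospectrality then fails, whence
  \<open>m \<ge> 2\<close> and a nonempty vertex set.\<close>

theorem theorem2:
  fixes G :: "'a pair_pre_digraph" and m :: nat
  assumes "pair_graph G" and "pverts G \<noteq> {}"
    and "m \<ge> 2"
    and "\<forall>\<sigma> \<in># seidel_spectrum G. \<bar>\<sigma>\<bar> \<ge> ((real m - 1) / real m)\<^sup>2"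
  shows "(seidel_noncospectral (D_star m (D m G)) (D m (D_star m G)) \<and>
          seidel_equienergetic (D_star m (D m G)) (D m (D_star m G)))
     \<longleftrightarrow> size {# \<sigma> \<in># seidel_spectrum G. \<sigma> > 0 #} = size {# \<sigma> \<in># seidel_spectrum G. \<sigma> < 0 #}"
proof -
  interpret pair_graph G by fact
  let ?n = "card (pverts G)" and ?A = "seidel_spectrum G"
  have n: "?n > 0"
    using assms(2) by (simp add: card_gt_0_iff)
  have m: "m > 0"
    using assms(3) by simp
  note spectra = seidel_spectrum_D_star_D[OF assms(1) m] seidel_spectrum_D_D_star[OF assms(1) m]
  \<comment> \<open>Neither \<open>- 1\<close> nor \<open>2 * m - 1\<close> equals \<open>1\<close>
    when \<open>m \<ge> 2\<close>, so only the shifted eigenvalues of \<open>G\<close> can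
    contribute.\<close>
  have "count (seidel_spectrum (D m (D_star m G))) 1 =
      count (image_mset (\<lambda>\<sigma>. (real m)\<^sup>2 * \<sigma> - (real m - 1)\<^sup>2) ?A) 1"
    using assms(3) by (simp add: spectra)
  also have "\<dots> \<le> size ?A"
    by (metis count_le_size size_image_mset)
  also have "\<dots> \<le> ?n"
    by (rule size_seidel_spectrum_le[OF assms(1)])
  \<comment> \<open>Shaped for the factorwise bounds \<open>1 \<le> m - 1\<close> and
    \<open>2 \<le> m\<close>.\<close>
  also have "\<dots> < 1 * (2 * ?n)"
    using n by simp
  also have "\<dots> \<le> (m - 1) * (m * ?n)"
    using assms(3) by (intro mult_le_mono) auto
  also have "\<dots> \<le> count (seidel_spectrum (D_star m (D m G))) 1"
    by (simp add: spectra)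
  finally have "seidel_noncospectral (D_star m (D m G)) (D m (D_star m G))"
    by (auto simp: seidel_noncospectral_def)
  moreover have "seidel_energy (D_star m (D m G)) - seidel_energy (D m (D_star m G)) =
      2 * (real m - 1)\<^sup>2 * (real (size {#\<sigma> \<in># ?A. \<sigma> > 0#}) - real (size {#\<sigma> \<in># ?A. \<sigma> < 0#}))"
  proof -
    \<comment> \<open>The replicated eigenvalues are opposite in the two spectra with equal
      multiplicities, so their contributions cancel.\<close>
    have "seidel_energy (D_star m (D m G)) - seidel_energy (D m (D_star m G)) =
        (\<Sum>\<sigma>\<in>#?A. \<bar>(real m)\<^sup>2 * \<sigma> + (real m - 1)\<^sup>2\<bar>) -
        (\<Sum>\<sigma>\<in>#?A. \<bar>(real m)\<^sup>2 * \<sigma> - (real m - 1)\<^sup>2\<bar>)"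
      by (simp add: seidel_energy_def spectra multiset.map_comp comp_def image_replicate_mset
          abs_minus_commute)
    also have "\<dots> = 2 * (real m - 1)\<^sup>2 *
        (real (size {#\<sigma> \<in># ?A. \<sigma> > 0#}) - real (size {#\<sigma> \<in># ?A. \<sigma> < 0#}))"
      using assms(3,4) by (intro sum_abs_shift_diff) (auto simp: power_divide)
    finally show ?thesis .
  qed
  then have "seidel_equienergetic (D_star m (D m G)) (D m (D_star m G)) \<longleftrightarrow>
      size {#\<sigma> \<in># ?A. \<sigma> > 0#} = size {#\<sigma> \<in># ?A. \<sigma> < 0#}"
    using assms(3) by (auto simp: seidel_equienergetic_def)
  ultimately show ?thesis
    by blast
qed

end
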